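(* Let $d\ge 1$, $n\ge 1$, let $X=\{X_1,\dots,X_n\}\subset\mathbb{R}^d$ be a finite set of points (the sample), and let $h>0$ be a real number. Let $\mathrm{MM}(X)$ be the min-max closure of $X$, let $m=|\mathrm{MM}(X)|$, and write $\mathrm{MM}(X)=\{X_1,\dots,X_n,\dots,X_m\}$. Then the totally positive kernel density estimator $$\hat f(\mathbf{x})=\frac1m\sum_{i=1}^m \frac{1}{h^d}\,N_d\!\left(\frac{\mathbf{x}-X_i}{h}\right),\qquad \mathbf{x}\in\mathbb{R}^d,$$ where $N_d$ is the density of the standard Gaussian on $\mathbb{R}^d$ (mean zero, identity covariance matrix), is an MTP$_2$ density on $\mathbb{R}^d$; that is, $\hat f$ is a probability density and $$\hat f(\mathbf{x})\,\hat f(\mathbf{y})\le \hat f(\mathbf{x}\wedge \mathbf{y})\,\hat f(\mathbf{x}\vee \mathbf{y})\qquad\text{for all }\mathbf{x},\mathbf{y}\in\mathbb{R}^d.$$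
   Context: For $\mathbf{x},\mathbf{y}\in\mathbb{R}^d$, $\mathbf{x}\wedge \mathbf{y}$ and $\mathbf{x}\vee \mathbf{y}$ denote the coordinate-wise minimum and maximum. A set $S\subseteq\mathbb{R}^d$ is min-max closed if $a\wedge b\in S$ and $a\vee b\in S$ for all $a,b\in S$. The min-max closure $\mathrm{MM}(X)$ of a finite set $X\subset\mathbb{R}^d$ is the smallest min-max closed set containing $X$; it is finite, since it is contained in the set of points whose $i$-th coordinate, for each $i$, equals the $i$-th coordinate of some point of $X$. A function $f:\mathbb{R}^d\to[0,\infty)$ is MTP$_2$ (multivariate totally positive of order 2) if $f(x)f(y)\le f(x\wedge y)f(x\vee y)$ for all $x,y\in\mathbb{R}^d$. The points $X_1,\dots,X_n$ are thought of as samples, but the statement is about an arbitrary finite set of points. *)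

theory Defs
  imports "HOL-Probability.Probability"
begin

definition min_max_closed :: "(real ^ 'd) set \<Rightarrow> bool"
  where "min_max_closed S \<longleftrightarrow> (\<forall>a\<in>S. \<forall>b\<in>S. inf a b \<in> S \<and> sup a b \<in> S)"

definition MM :: "(real ^ 'd) set \<Rightarrow> (real ^ 'd) set"
  where "MM X = min_max_closed hull X"

lemma inf_vec_nth: "inf a b $ i = min (a $ i) (b $ i)" for a b :: "real ^ 'd"
  by (simp add: inf_vec_def inf_min)

lemma sup_vec_nth: "sup a b $ i = max (a $ i) (b $ i)" for a b :: "real ^ 'd"
  by (simp add: sup_vec_def sup_max)

lemma min_max_closed_MM: "min_max_closed (MM X)"
  unfolding MM_def by (rule hull_in) (auto simp: min_max_closed_def)

lemma subset_MM: "X \<subseteq> MM X"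
  unfolding MM_def by (rule hull_subset)

text \<open>Without finiteness, \<^term>\<open>card (MM X)\<close> would be \<open>0\<close> by convention.\<close>

lemma finite_MM:
  fixes X :: "(real ^ 'd) set"
  assumes "finite X"
  shows "finite (MM X)"
proof -
  let ?G = "{v. \<forall>i. v $ i \<in> (\<lambda>x. x $ i) ` X}"
  have "min_max_closed ?G"
    unfolding min_max_closed_def mem_Collect_eq inf_vec_nth sup_vec_nth
    by (simp add: min_def max_def)
  then have "MM X \<subseteq> ?G"
    unfolding MM_def by (intro hull_minimal) auto
  moreover have "finite ?G"
  proof -
    have "finite (PiE UNIV (\<lambda>i. (\<lambda>x. x $ i) ` X))"
      using assms by (intro finite_PiE) auto
    moreover have "?G \<subseteq> vec_lambda ` PiE UNIV (\<lambda>i. (\<lambda>x. x $ i) ` X)"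
    proof
      fix v assume "v \<in> ?G"
      then have "vec_nth v \<in> PiE UNIV (\<lambda>i. (\<lambda>x. x $ i) ` X)"
        by (simp add: PiE_iff)
      then show "v \<in> vec_lambda ` PiE UNIV (\<lambda>i. (\<lambda>x. x $ i) ` X)"
        by (metis imageI vec_nth_inverse)
    qed
    ultimately show ?thesis
      using finite_surj by blast
  qed
  ultimately show ?thesis
    by (rule finite_subset)
qed

definition std_gaussian_density :: "real ^ 'd \<Rightarrow> real"
  where "std_gaussian_density x = exp (- (norm x)\<^sup>2 / 2) / sqrt ((2 * pi) ^ CARD('d))"

definition mtp2 :: "(real ^ 'd \<Rightarrow> real) \<Rightarrow> bool"
  where "mtp2 f \<longleftrightarrow> (\<forall>x. 0 \<le> f x) \<and> (\<forall>x y. f x * f y \<le> f (inf x y) * f (sup x y))"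

definition prob_density :: "(real ^ 'd \<Rightarrow> real) \<Rightarrow> bool"
  where "prob_density f \<longleftrightarrow>
    f \<in> borel_measurable borel \<and> (\<forall>x. 0 \<le> f x) \<and> (\<integral>\<^sup>+x. ennreal (f x) \<partial>lborel) = 1"

definition tp_kde :: "real \<Rightarrow> (real ^ 'd) set \<Rightarrow> real ^ 'd \<Rightarrow> real"
  where "tp_kde h X x =
    1 / real (card (MM X)) *
      (\<Sum>p\<in>MM X. 1 / h ^ CARD('d) * std_gaussian_density ((1 / h) *\<^sub>R (x - p)))"

end

theory Submission
  imports Defs
begin

text \<open>
  The estimator is a probability density because it is the average of the densities of the
  normal distributions centred at the points of \<^term>\<open>MM X\<close>, each of which is a product
  of one-dimensional normal densities (\<open>nn_integral_gaussian_kernel\<close>).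

  For the MTP\<open>\<^sub>2\<close> inequality, the product of the estimates at \<open>x\<close> and \<open>y\<close> expands into a
  double sum over centres \<open>p\<close> and \<open>q\<close>. The Gaussian kernel, as a function of the point and the
  centre together, satisfies
  \<open>K(p, x) * K(q, y) \<le> K(inf p q, inf x y) * K(sup p q, sup x y)\<close>
  (\<open>gaussian_kernel_mult_le\<close>), since in each coordinate sorting both pairs of numbers
  does not increase the sum of the squared differences. This alone does not bound the double sum,
  because the map \<open>(p, q) \<mapsto> (inf p q, sup p q)\<close> is not injective. What bridges the gap is the
  four functions theorem of Ahlswede and Daykin: on a finite distributive lattice such a
  pointwise inequality between four nonnegative functions implies the same inequality between
  their sums. It applies because \<^term>\<open>MM X\<close> is a finite sublattice of the space, and this is
  where the min-max closure is essential.

  The four functions theorem is obtained here for chains (\<open>four_functions_chain\<close>), then for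
  finite products of chains by summing out one coordinate at a time
  (\<open>four_functions_PiE\<close>), and then for finite min-max closed sets by extending the functions by
  zero to a surrounding grid (\<open>four_functions_min_max_closed\<close>).
\<close>

section \<open>The four functions theorem\<close>

text \<open>After symmetrising the double sums it suffices to compare, for \<open>s \<le> t\<close>, the two terms
  \<open>A\<close>, \<open>B\<close> on the left with the two terms \<open>C\<close>, \<open>D\<close> on the right. The hypothesis at \<open>(s, t)\<close> and
  \<open>(t, s)\<close> bounds both \<open>A\<close> and \<open>B\<close> by \<open>C\<close>, the term with the smaller argument in \<open>\<gamma>\<close>, whereas at
  \<open>(s, s)\<close> and \<open>(t, t)\<close> it gives \<open>A * B \<le> C * D\<close>. Then \<open>A + B \<le> C + D\<close> follows by expanding
  \<open>(C - A) * (C - B) \<ge> 0\<close>.\<close>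

lemma four_functions_chain:
  fixes \<alpha> \<beta> \<gamma> \<delta> :: "'a::linorder \<Rightarrow> real"
  assumes nonneg: "\<And>t. t \<in> T \<Longrightarrow> 0 \<le> \<alpha> t \<and> 0 \<le> \<beta> t \<and> 0 \<le> \<gamma> t \<and> 0 \<le> \<delta> t"
    and le: "\<And>s t. s \<in> T \<Longrightarrow> t \<in> T \<Longrightarrow> \<alpha> s * \<beta> t \<le> \<gamma> (min s t) * \<delta> (max s t)"
  shows "sum \<alpha> T * sum \<beta> T \<le> sum \<gamma> T * sum \<delta> T"
proof -
  have ordered: "\<alpha> s * \<beta> t + \<alpha> t * \<beta> s \<le> \<gamma> s * \<delta> t + \<gamma> t * \<delta> s"
    if "s \<in> T" "t \<in> T" "s \<le> t" for s t
  proof -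
    define A B C D where "A = \<alpha> s * \<beta> t" and "B = \<alpha> t * \<beta> s" and "C = \<gamma> s * \<delta> t" and "D = \<gamma> t * \<delta> s"
    have AC: "A \<le> C" and BC: "B \<le> C"
      using le[of s t] le[of t s] that by (auto simp: A_def B_def C_def min_def max_def split: if_splits)
    have nn: "0 \<le> A" "0 \<le> B" "0 \<le> D"
      using nonneg that by (simp_all add: A_def B_def D_def)
    have "(\<alpha> s * \<beta> s) * (\<alpha> t * \<beta> t) \<le> (\<gamma> s * \<delta> s) * (\<gamma> t * \<delta> t)"
      using le[of s s] le[of t t] nonneg that by (intro mult_mono[where a = "\<alpha> s * \<beta> s"]) auto
    then have ABCD: "A * B \<le> C * D"
      by (simp add: A_def B_def C_def D_def mult_ac)
    have "0 \<le> (C - A) * (C - B)"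
      using AC BC by simp
    then have C: "C * (A + B) \<le> C * (C + D)"
      using ABCD by (simp add: algebra_simps)
    have "A + B \<le> C + D"
    proof (cases "C = 0")
      case True
      then show ?thesis using AC BC nn by linarith
    next
      case False
      then have "0 < C" using AC nn by linarith
      then show ?thesis using C by simp
    qed
    then show ?thesis by (simp add: A_def B_def C_def D_def)
  qed
  have swap: "2 * (sum f T * sum g T) = (\<Sum>s\<in>T. \<Sum>t\<in>T. f s * g t + f t * g s)"
    for f g :: "'a \<Rightarrow> real"
  proof -
    have "sum f T * sum g T = (\<Sum>s\<in>T. \<Sum>t\<in>T. f s * g t)"
      by (rule sum_product)
    moreover have "\<dots> = (\<Sum>s\<in>T. \<Sum>t\<in>T. f t * g s)"
      by (rule sum.swap)
    ultimately show ?thesis by (simp add: sum.distrib)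
  qed
  have "2 * (sum \<alpha> T * sum \<beta> T) \<le> 2 * (sum \<gamma> T * sum \<delta> T)"
    unfolding swap
  proof (intro sum_mono)
    fix s t assume "s \<in> T" "t \<in> T"
    then show "\<alpha> s * \<beta> t + \<alpha> t * \<beta> s \<le> \<gamma> s * \<delta> t + \<gamma> t * \<delta> s"
      using ordered[of s t] ordered[of t s] by (cases "s \<le> t") (auto simp: add.commute)
  qed
  then show ?thesis by simp
qed

text \<open>Summing out all coordinates in \<open>I\<close> turns the four functions into functions of the
  coordinate \<open>i\<close> alone. The induction hypothesis, applied to the slices at \<open>s\<close>, \<open>t\<close>, \<open>min s t\<close> and
  \<open>max s t\<close>, says precisely that these marginals satisfy the hypothesis of the theorem for
  chains. Pointwise \<open>min\<close> and \<open>max\<close> stay in the product because they fix the default value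
  \<open>undefined\<close> outside \<open>I\<close>; for empty \<open>I\<close> the hypothesis is therefore the claim itself.\<close>

lemma four_functions_PiE:
  fixes \<alpha> \<beta> \<gamma> \<delta> :: "('i \<Rightarrow> 'a::linorder) \<Rightarrow> real"
  assumes "finite I"
    and "\<And>f. f \<in> PiE I S \<Longrightarrow> 0 \<le> \<alpha> f \<and> 0 \<le> \<beta> f \<and> 0 \<le> \<gamma> f \<and> 0 \<le> \<delta> f"
    and "\<And>f g. f \<in> PiE I S \<Longrightarrow> g \<in> PiE I S \<Longrightarrow>
      \<alpha> f * \<beta> g \<le> \<gamma> (\<lambda>i. min (f i) (g i)) * \<delta> (\<lambda>i. max (f i) (g i))"
  shows "sum \<alpha> (PiE I S) * sum \<beta> (PiE I S) \<le> sum \<gamma> (PiE I S) * sum \<delta> (PiE I S)"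
  using assms
proof (induction I arbitrary: \<alpha> \<beta> \<gamma> \<delta> rule: finite_induct)
  case empty
  then show ?case by simp
next
  case (insert i I)
  have upd: "f(i := t) \<in> PiE (insert i I) S" if "f \<in> PiE I S" "t \<in> S i" for f t
    using that by (simp add: PiE_fun_upd)
  have fubini: "sum \<phi> (PiE (insert i I) S) = (\<Sum>t\<in>S i. \<Sum>f\<in>PiE I S. \<phi> (f(i := t)))"
    for \<phi> :: "('i \<Rightarrow> 'a) \<Rightarrow> real"
  proof -
    have "sum \<phi> (PiE (insert i I) S) = (\<Sum>(t, f)\<in>S i \<times> PiE I S. \<phi> (f(i := t)))"
      unfolding PiE_insert_eq using insert.hyps
      by (subst sum.reindex[OF inj_combinator]) (auto simp: case_prod_beta intro: sum.cong)
    then show ?thesis by (simp add: sum.cartesian_product)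
  qed
  show ?case
    unfolding fubini
  proof (rule four_functions_chain)
    fix t assume t: "t \<in> S i"
    show "0 \<le> (\<Sum>f\<in>PiE I S. \<alpha> (f(i := t))) \<and> 0 \<le> (\<Sum>f\<in>PiE I S. \<beta> (f(i := t)))
        \<and> 0 \<le> (\<Sum>f\<in>PiE I S. \<gamma> (f(i := t))) \<and> 0 \<le> (\<Sum>f\<in>PiE I S. \<delta> (f(i := t)))"
      using insert.prems(1)[OF upd[OF _ t]] by (intro conjI sum_nonneg) blast+
  next
    fix s t assume s: "s \<in> S i" and t: "t \<in> S i"
    have m: "min s t \<in> S i" "max s t \<in> S i"
      using s t by (auto simp: min_def max_def)
    show "(\<Sum>f\<in>PiE I S. \<alpha> (f(i := s))) * (\<Sum>f\<in>PiE I S. \<beta> (f(i := t)))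
        \<le> (\<Sum>f\<in>PiE I S. \<gamma> (f(i := min s t))) * (\<Sum>f\<in>PiE I S. \<delta> (f(i := max s t)))"
    proof (rule insert.IH)
      fix f assume f: "f \<in> PiE I S"
      show "0 \<le> \<alpha> (f(i := s)) \<and> 0 \<le> \<beta> (f(i := t)) \<and>
          0 \<le> \<gamma> (f(i := min s t)) \<and> 0 \<le> \<delta> (f(i := max s t))"
        using insert.prems(1)[OF upd[OF f]] s t m by blast
    next
      fix f g assume f: "f \<in> PiE I S" and g: "g \<in> PiE I S"
      have eq: "(\<lambda>j. min ((f(i := s)) j) ((g(i := t)) j)) = (\<lambda>j. min (f j) (g j))(i := min s t)"
        "(\<lambda>j. max ((f(i := s)) j) ((g(i := t)) j)) = (\<lambda>j. max (f j) (g j))(i := max s t)"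
        by auto
      show "\<alpha> (f(i := s)) * \<beta> (g(i := t)) \<le>
          \<gamma> ((\<lambda>j. min (f j) (g j))(i := min s t)) * \<delta> ((\<lambda>j. max (f j) (g j))(i := max s t))"
        using insert.prems(2)[OF upd[OF f s] upd[OF g t]] unfolding eq .
    qed
  qed
qed

text \<open>The grid spanned by the coordinates of \<open>M\<close> is a finite product of chains containing \<open>M\<close>.
  Extension by zero preserves the hypothesis: the left-hand side vanishes unless both arguments
  lie in \<open>M\<close>, and then their infimum and supremum lie in \<open>M\<close> as well.\<close>

lemma four_functions_min_max_closed:
  fixes \<alpha> \<beta> \<gamma> \<delta> :: "real ^ 'd \<Rightarrow> real"
  assumes "finite M" and closed: "min_max_closed M"
    and nonneg: "\<And>p. p \<in> M \<Longrightarrow> 0 \<le> \<alpha> p \<and> 0 \<le> \<beta> p \<and> 0 \<le> \<gamma> p \<and> 0 \<le> \<delta> p"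
    and le: "\<And>p q. p \<in> M \<Longrightarrow> q \<in> M \<Longrightarrow> \<alpha> p * \<beta> q \<le> \<gamma> (inf p q) * \<delta> (sup p q)"
  shows "sum \<alpha> M * sum \<beta> M \<le> sum \<gamma> M * sum \<delta> M"
proof -
  define S where "S i = (\<lambda>p. p $ i) ` M" for i
  define ext where "ext \<phi> f = (if vec_lambda f \<in> M then \<phi> (vec_lambda f) else 0)"
    for \<phi> :: "real ^ 'd \<Rightarrow> real" and f
  have sum_ext: "sum \<phi> M = sum (ext \<phi>) (PiE UNIV S)" for \<phi>
  proof -
    have "sum \<phi> M = sum (ext \<phi>) (vec_nth ` M)"
      by (subst sum.reindex) (auto simp: inj_on_def vec_eq_iff ext_def intro!: sum.cong)
    also have "\<dots> = sum (ext \<phi>) (PiE UNIV S)"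
    proof (rule sum.mono_neutral_left)
      show "finite (PiE UNIV S)"
        using \<open>finite M\<close> by (intro finite_PiE) (auto simp: S_def)
      show "vec_nth ` M \<subseteq> PiE UNIV S"
        by (auto simp: S_def)
      show "\<forall>f\<in>PiE UNIV S - vec_nth ` M. ext \<phi> f = 0"
        by (auto simp: ext_def image_iff) (metis vec_lambda_inverse UNIV_I)
    qed
    finally show ?thesis .
  qed
  have inf_eq: "vec_lambda (\<lambda>i. min (f i) (g i)) = inf (vec_lambda f) (vec_lambda g)"
    and sup_eq: "vec_lambda (\<lambda>i. max (f i) (g i)) = sup (vec_lambda f) (vec_lambda g)"
    for f g :: "'d \<Rightarrow> real"
    by (simp_all add: vec_eq_iff inf_vec_nth sup_vec_nth)
  show ?thesis
    unfolding sum_ext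
  proof (rule four_functions_PiE)
    show ext_nonneg: "0 \<le> ext \<alpha> f \<and> 0 \<le> ext \<beta> f \<and> 0 \<le> ext \<gamma> f \<and> 0 \<le> ext \<delta> f" for f
      using nonneg by (simp add: ext_def)
    show "ext \<alpha> f * ext \<beta> g \<le> ext \<gamma> (\<lambda>i. min (f i) (g i)) * ext \<delta> (\<lambda>i. max (f i) (g i))" for f g
    proof (cases "vec_lambda f \<in> M \<and> vec_lambda g \<in> M")
      case True
      then show ?thesis
        using le closed by (simp add: ext_def inf_eq sup_eq min_max_closed_def)
    next
      case False
      then have "ext \<alpha> f * ext \<beta> g = 0" by (auto simp: ext_def)
      then show ?thesis using ext_nonneg by (metis mult_nonneg_nonneg)
    qed
  qed simp
qed

section \<open>Gaussian kernels\<close>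

text \<open>The squared norm is a sum over coordinates, so this is the rearrangement inequality for
  two pairs of reals: if \<open>a \<le> b\<close> and \<open>e \<le> c\<close>, then sorting the second pair lowers the sum of
  squares by \<open>2 * (b - a) * (c - e)\<close>.\<close>

lemma norm_diff_inf_sup_le:
  fixes x y p q :: "real ^ 'd"
  shows "(norm (inf x y - inf p q))\<^sup>2 + (norm (sup x y - sup p q))\<^sup>2
    \<le> (norm (x - p))\<^sup>2 + (norm (y - q))\<^sup>2"
proof -
  have coord: "(min a b - min c e)\<^sup>2 + (max a b - max c e)\<^sup>2 \<le> (a - c)\<^sup>2 + (b - e)\<^sup>2"
    for a b c e :: real
  proof -
    have "0 \<le> (b - a) * (c - e)" if "a \<le> b" "e \<le> c"
      using that by simp
    moreover have "0 \<le> (a - b) * (e - c)" if "b \<le> a" "c \<le> e"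
      using that by simp
    ultimately show ?thesis
      by (auto simp: min_def max_def power2_eq_square algebra_simps)
  qed
  have norm2: "(norm v)\<^sup>2 = (\<Sum>i\<in>UNIV. (v $ i)\<^sup>2)" for v :: "real ^ 'd"
    by (simp add: norm_vec_def L2_set_def sum_nonneg)
  show ?thesis
    unfolding norm2 sum.distrib[symmetric]
    using coord by (intro sum_mono) (simp add: inf_vec_nth sup_vec_nth)
qed

definition gaussian_kernel :: "real \<Rightarrow> real ^ 'd \<Rightarrow> real ^ 'd \<Rightarrow> real"
  where "gaussian_kernel h p x =
    1 / h ^ CARD('d) * std_gaussian_density ((1 / h) *\<^sub>R (x - p))"

lemma gaussian_kernel_nonneg: "0 < h \<Longrightarrow> 0 \<le> gaussian_kernel h p x"
  by (simp add: gaussian_kernel_def std_gaussian_density_def)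

lemma gaussian_kernel_eq_exp:
  fixes p x :: "real ^ 'd"
  shows "gaussian_kernel h p x =
    1 / (h ^ CARD('d) * sqrt ((2 * pi) ^ CARD('d))) * exp (- (norm (x - p))\<^sup>2 / (2 * h\<^sup>2))"
proof -
  have "(norm ((1 / h) *\<^sub>R (x - p)))\<^sup>2 = (norm (x - p))\<^sup>2 / h\<^sup>2"
    by (simp only: norm_scaleR) (simp add: power_mult_distrib power_divide)
  then show ?thesis
    by (simp only: gaussian_kernel_def std_gaussian_density_def) (simp add: mult.commute)
qed

text \<open>Both sides have the same normalising constant, so only the exponents are compared.\<close>

lemma gaussian_kernel_mult_le:
  fixes p q x y :: "real ^ 'd"
  shows "gaussian_kernel h p x * gaussian_kernel h q y
    \<le> gaussian_kernel h (inf p q) (inf x y) * gaussian_kernel h (sup p q) (sup x y)"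
proof -
  define c where "c = 1 / (h ^ CARD('d) * sqrt ((2 * pi) ^ CARD('d)))"
  have mult: "gaussian_kernel h a u * gaussian_kernel h b v
      = c\<^sup>2 * exp (- ((norm (u - a))\<^sup>2 + (norm (v - b))\<^sup>2) / (2 * h\<^sup>2))" for a b u v :: "real ^ 'd"
    unfolding gaussian_kernel_eq_exp c_def[symmetric]
    by (simp add: power2_eq_square exp_add[symmetric] add_divide_distrib diff_divide_distrib)
  show ?thesis
    unfolding mult using norm_diff_inf_sup_le[of x y p q]
    by (intro mult_left_mono) (auto intro!: divide_right_mono)
qed

text \<open>The identity covariance makes the coordinates independent; the bandwidth \<open>h\<close> is the
  standard deviation of each of them.\<close>

lemma gaussian_kernel_eq_prod:
  fixes p x :: "real ^ 'd"
  assumes "0 < h"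
  shows "gaussian_kernel h p x = (\<Prod>b\<in>Basis. normal_density (p \<bullet> b) h (x \<bullet> b))"
proof -
  have "(\<Prod>b\<in>(Basis :: (real ^ 'd) set). normal_density (p \<bullet> b) h (x \<bullet> b))
      = (1 / sqrt (2 * pi * h\<^sup>2)) ^ CARD('d) * exp (\<Sum>b\<in>Basis. - (x \<bullet> b - p \<bullet> b)\<^sup>2 / (2 * h\<^sup>2))"
    unfolding normal_density_def by (simp add: prod.distrib exp_sum prod_dividef power_one_over)
  also have "(\<Sum>b\<in>Basis. - (x \<bullet> b - p \<bullet> b)\<^sup>2 / (2 * h\<^sup>2)) = - (norm (x - p))\<^sup>2 / (2 * h\<^sup>2)"
  proof -
    have "(norm (x - p))\<^sup>2 = (\<Sum>b\<in>Basis. (x \<bullet> b - p \<bullet> b)\<^sup>2)"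
      unfolding power2_norm_eq_inner euclidean_inner[of "x - p" "x - p"]
      by (simp add: inner_diff_left power2_eq_square)
    then show ?thesis by (simp add: sum_negf sum_divide_distrib)
  qed
  also have "(1 / sqrt (2 * pi * h\<^sup>2)) ^ CARD('d) = 1 / (h ^ CARD('d) * sqrt ((2 * pi) ^ CARD('d)))"
    using assms by (simp add: real_sqrt_mult real_sqrt_power power_mult_distrib power_divide)
  finally show ?thesis by (simp add: gaussian_kernel_eq_exp)
qed

lemma gaussian_kernel_measurable [measurable]:
  "gaussian_kernel h p \<in> borel_measurable borel"
  unfolding gaussian_kernel_eq_exp[abs_def] by measurable

lemma nn_integral_gaussian_kernel:
  fixes p :: "real ^ 'd"
  assumes "0 < h"
  shows "(\<integral>\<^sup>+x. ennreal (gaussian_kernel h p x) \<partial>lborel) = 1"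
proof -
  have "(\<integral>\<^sup>+x. ennreal (gaussian_kernel h p x) \<partial>lborel)
      = (\<integral>\<^sup>+x. (\<Prod>b\<in>Basis. ennreal (normal_density (p \<bullet> b) h (x \<bullet> b))) \<partial>lborel)"
    using assms by (simp add: gaussian_kernel_eq_prod prod_ennreal)
  also have "\<dots> = (\<Prod>b\<in>(Basis :: (real ^ 'd) set). \<integral>\<^sup>+t. ennreal (normal_density (p \<bullet> b) h t) \<partial>lborel)"
    by (rule nn_integral_lborel_prod) auto
  also have "\<dots> = 1"
    using assms by (simp add: nn_integral_eq_integral integrable_normal_density integral_normal_density)
  finally show ?thesis .
qed

section \<open>The totally positive kernel density estimator\<close>

lemma tp_kde_eq: "tp_kde h X x = (\<Sum>p\<in>MM X. gaussian_kernel h p x) / real (card (MM X))"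
  by (simp add: tp_kde_def gaussian_kernel_def)

theorem theorem4:
  fixes X :: "(real ^ 'd) set" and h :: real
  assumes "finite X" and "X \<noteq> {}" and "h > 0"
  shows "prob_density (tp_kde h X) \<and> mtp2 (tp_kde h X)"
proof
  have fin: "finite (MM X)" by (rule finite_MM) fact
  have "MM X \<noteq> {}" using subset_MM[of X] \<open>X \<noteq> {}\<close> by auto
  then have card: "0 < card (MM X)" using fin by (simp add: card_gt_0_iff)
  have nonneg: "0 \<le> tp_kde h X x" for x
    using \<open>h > 0\<close> by (simp add: tp_kde_eq sum_nonneg gaussian_kernel_nonneg)
  show "prob_density (tp_kde h X)"
    unfolding prob_density_def
  proof (intro conjI allI nonneg)
    show "tp_kde h X \<in> borel_measurable borel"
      unfolding tp_kde_eq[abs_def] by measurable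
    have "(\<integral>\<^sup>+x. ennreal (tp_kde h X x) \<partial>lborel)
        = (\<integral>\<^sup>+x. (\<Sum>p\<in>MM X. ennreal (gaussian_kernel h p x)) / of_nat (card (MM X)) \<partial>lborel)"
      using \<open>h > 0\<close> card
      by (simp add: tp_kde_eq divide_ennreal[symmetric] sum_nonneg gaussian_kernel_nonneg
          sum_ennreal ennreal_of_nat_eq_real_of_nat)
    also have "\<dots> = (\<Sum>p\<in>MM X. \<integral>\<^sup>+x. ennreal (gaussian_kernel h p x) \<partial>lborel) / of_nat (card (MM X))"
      by (simp add: nn_integral_divide nn_integral_sum)
    also have "\<dots> = 1"
      using \<open>h > 0\<close> card
      by (simp add: nn_integral_gaussian_kernel ennreal_divide_self of_nat_less_top less_top[symmetric])
    finally show "(\<integral>\<^sup>+x. ennreal (tp_kde h X x) \<partial>lborel) = 1" .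
  qed
  show "mtp2 (tp_kde h X)"
    unfolding mtp2_def
  proof (intro conjI allI nonneg)
    fix x y
    have "(\<Sum>p\<in>MM X. gaussian_kernel h p x) * (\<Sum>p\<in>MM X. gaussian_kernel h p y)
        \<le> (\<Sum>p\<in>MM X. gaussian_kernel h p (inf x y)) * (\<Sum>p\<in>MM X. gaussian_kernel h p (sup x y))"
      using fin min_max_closed_MM
      by (rule four_functions_min_max_closed)
        (simp_all add: \<open>h > 0\<close> gaussian_kernel_nonneg gaussian_kernel_mult_le)
    then show "tp_kde h X x * tp_kde h X y \<le> tp_kde h X (inf x y) * tp_kde h X (sup x y)"
      by (simp add: tp_kde_eq divide_right_mono)
  qed
qed

end
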